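(* For a binary sequence $d$ let $Z^{(d)}(\beta)$, $|\beta|<\tfrac12$, be the power series defined in the context. Then, for every $\alpha\in[0,1]$, $$\mathbf{v}(\alpha):=\left.\frac{\mathrm{d}Z^{(\pi^{-1}(\alpha))}(\beta)}{\mathrm{d}\beta}\right|_{\beta=0}=2\,\mathrm{i}\,\mathrm{T}(\alpha),$$ where $\mathrm{T}$ is the Takagi function and $\pi^{-1}(\alpha)$ is the binary digit sequence of $\alpha$.
   Context: **Takagi function.** $\mathrm{T}(x)=\sum_{n=0}^{\infty}\sigma(2^nx)/2^n$ for $x\in[0,1]$, where $\sigma(x)=\min_{n\in\mathbb{Z}}|x-n|$. **Binary sequences.** $\Omega$ is the set of infinite binary sequences $d=(d_1,d_2,\ldots)\in\{0,1\}^{\mathbb{N}}$, where, for uniqueness of binary representations, sequences that are eventually all ones are excluded, with the exception of $d=(1,1,1,\ldots)$. Then $\pi:\Omega\to[0,1]$, $\pi(d)=\sum_{k\geqslant1}d_k2^{-k}$, is a bijection. **The maps and the series.** For real $\beta$ put $t=\tfrac12+\mathrm{i}\beta$, $f^{(0)}(z)=tz$ and $f^{(1)}(z)=(1-t)z+t$. For $d\in\Omega$ and $n\geqslant0$ let $Z_n^{(d)}(\beta)=f^{(d_1)}\circ f^{(d_2)}\circ\cdots\circ f^{(d_n)}(0)$ (with $Z_0^{(d)}=0$). This is a polynomial in $\mathrm{i}\beta$, $Z_n^{(d)}(\beta)=\sum_{k\geqslant0}a_{k,n}^{(d)}(\mathrm{i}\beta)^k$, with coefficients $a_{k,n}^{(d)}\in\mathbb{Z}[1/2]$.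 For each $k$ and $d$ the limit $a_k^{(d)}=\lim_{n\to\infty}a_{k,n}^{(d)}$ exists, and $Z^{(d)}(\beta)=\sum_{k\geqslant0}a_k^{(d)}(\mathrm{i}\beta)^k$ is the resulting (coefficientwise) limit of $Z_n^{(d)}$, a power series convergent for $|\beta|<\tfrac12$. *)

theory Defs
  imports "HOL-Analysis.Analysis" "HOL-Computational_Algebra.Polynomial"
begin

(* The infimum over the integers is attained, so this is the distance to the nearest integer. *)
definition int_dist :: "real \<Rightarrow> real" where
  "int_dist x = (INF n::int. \<bar>x - of_int n\<bar>)"

definition takagi :: "real \<Rightarrow> real" where
  "takagi x = (\<Sum>n. int_dist (2 ^ n * x) / 2 ^ n)"

(* Binary sequences are indexed from 0: the digit d_(k+1) of the mathematical sequence
   (d_1, d_2, ...) is "of_bool (d k)". *)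
definition Omega :: "(nat \<Rightarrow> bool) set" where
  "Omega = {d. \<not> (\<forall>\<^sub>F k in sequentially. d k) \<or> d = (\<lambda>_. True)}"

definition binary_value :: "(nat \<Rightarrow> bool) \<Rightarrow> real" where
  "binary_value d = (\<Sum>k. of_bool (d k) / 2 ^ (k + 1))"

definition binary_digits :: "real \<Rightarrow> nat \<Rightarrow> bool" where
  "binary_digits = inv_into Omega binary_value"

(* The maps f^(0) and f^(1), over an arbitrary commutative ring, so that the same composition
   can be formed both for a complex number t and for the polynomial t = 1/2 + X. *)
definition fmap :: "'a::comm_ring_1 \<Rightarrow> bool \<Rightarrow> 'a \<Rightarrow> 'a" where
  "fmap t b z = (if b then (1 - t) * z + t else t * z)"

definition fcomp_zero :: "'a::comm_ring_1 \<Rightarrow> (nat \<Rightarrow> bool) \<Rightarrow> nat \<Rightarrow> 'a" where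
  "fcomp_zero t d n = foldr (\<lambda>k. fmap t (d k)) [0..<n] 0"

definition Z_fin :: "(nat \<Rightarrow> bool) \<Rightarrow> nat \<Rightarrow> real \<Rightarrow> complex" where
  "Z_fin d n \<beta> = fcomp_zero (1 / 2 + \<i> * of_real \<beta>) d n"

(* Z_fin as a polynomial in the indeterminate X = i * beta; see Z_fin_eq_sum below. *)
definition Z_poly :: "(nat \<Rightarrow> bool) \<Rightarrow> nat \<Rightarrow> real poly" where
  "Z_poly d n = fcomp_zero [:1 / 2, 1:] d n"

definition a_fin :: "(nat \<Rightarrow> bool) \<Rightarrow> nat \<Rightarrow> nat \<Rightarrow> real" where
  "a_fin d k n = coeff (Z_poly d n) k"

definition a_lim :: "(nat \<Rightarrow> bool) \<Rightarrow> nat \<Rightarrow> real" where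
  "a_lim d k = lim (\<lambda>n. a_fin d k n)"

definition Z :: "(nat \<Rightarrow> bool) \<Rightarrow> real \<Rightarrow> complex" where
  "Z d \<beta> = (\<Sum>k. of_real (a_lim d k) * (\<i> * of_real \<beta>) ^ k)"

lemma Z_fin_eq_poly: "Z_fin d n \<beta> = poly (map_poly of_real (Z_poly d n)) (\<i> * of_real \<beta>)"
proof -
  let ?ev = "\<lambda>p. poly (map_poly complex_of_real p) (\<i> * of_real \<beta>)"
  have add: "?ev (p + q) = ?ev p + ?ev q" for p q
  proof -
    have "map_poly complex_of_real (p + q) = map_poly of_real p + map_poly of_real q"
      by (intro poly_eqI) (simp add: coeff_map_poly)
    then show ?thesis by simp
  qed
  have mult: "?ev (p * q) = ?ev p * ?ev q" for p q
  proof -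
    have "map_poly complex_of_real (p * q) = map_poly of_real p * map_poly of_real q"
      by (intro poly_eqI) (simp add: coeff_map_poly coeff_mult)
    then show ?thesis by simp
  qed
  have t: "?ev [:1 / 2, 1:] = 1 / 2 + \<i> * of_real \<beta>"
    by (simp add: map_poly_pCons)
  have t': "?ev (1 - [:1 / 2, 1:]) = 1 - (1 / 2 + \<i> * of_real \<beta>)"
    by (simp add: map_poly_pCons one_pCons)
  have "?ev (foldr (\<lambda>k. fmap [:1 / 2, 1:] (d k)) ks 0)
      = foldr (\<lambda>k. fmap (1 / 2 + \<i> * of_real \<beta>) (d k)) ks 0" for ks
    by (induction ks) (simp_all add: fmap_def add mult t t' del: mult_pCons_left)
  then show ?thesis
    by (simp add: Z_fin_def Z_poly_def fcomp_zero_def)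
qed

lemma Z_fin_eq_sum:
  "Z_fin d n \<beta> = (\<Sum>k\<le>degree (Z_poly d n). of_real (a_fin d k n) * (\<i> * of_real \<beta>) ^ k)"
  unfolding Z_fin_eq_poly poly_altdef a_fin_def
  by (simp add: coeff_map_poly degree_map_poly)

end

(* Write d' for the sequence d without its first digit.  Reading off the coefficients of X^k in
   Z_(n+1)^(d) = f^(d_1)(Z_n^(d')) gives a recursion that makes the coefficients converge
   geometrically and bounds them by 2^k.  For k = 1 the limit is a_1(d) = a_1(d')/2 + 2 sigma(pi d),
   and 2 T(pi d) satisfies the same equation since T(x) = sigma(x) + T(2x)/2.  Their difference e
   is bounded and satisfies e(d) = e(d')/2, so it is zero. *)
theory Submission
  imports Defs
begin

section \<open>Recursion, bounds and convergence of the coefficients\<close>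

lemma fcomp_zero_0 [simp]: "fcomp_zero t d 0 = 0"
  by (simp add: fcomp_zero_def)

lemma fcomp_zero_Suc: "fcomp_zero t d (Suc n) = fmap t (d 0) (fcomp_zero t (\<lambda>k. d (Suc k)) n)"
proof -
  have "[0..<Suc n] = 0 # map Suc [0..<n]"
    by (simp add: upt_conv_Cons map_Suc_upt del: upt_Suc)
  then show ?thesis
    by (simp add: fcomp_zero_def foldr_map comp_def del: upt_Suc)
qed

lemma a_fin_0 [simp]: "a_fin d k 0 = 0"
  by (simp add: a_fin_def Z_poly_def)

lemma a_fin_0_Suc: "a_fin d 0 (Suc n) = a_fin (\<lambda>k. d (Suc k)) 0 n / 2 + of_bool (d 0) / 2"
  by (simp add: a_fin_def Z_poly_def fcomp_zero_Suc fmap_def coeff_mult)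

text \<open>Since \<open>t = 1/2 + X\<close> and \<open>1 - t = 1/2 - X\<close>, both maps halve the
  coefficient of the same order and add or subtract the one of the order below. The translation by
  \<open>t\<close> contributes 1 to the coefficient of \<open>X\<close> only.\<close>

lemma a_fin_Suc_Suc:
  "a_fin d (Suc k) (Suc n) = a_fin (\<lambda>k. d (Suc k)) (Suc k) n / 2 +
    (if d 0 then of_bool (k = 0) - a_fin (\<lambda>k. d (Suc k)) k n else a_fin (\<lambda>k. d (Suc k)) k n)"
proof -
  have "1 - [:1 / 2, 1:] = [:1 / 2, -1 :: real:]"
    by (simp add: one_pCons)
  moreover have "coeff [:1 / 2, 1 :: real:] (Suc k) = of_bool (k = 0)"
    by (cases k) auto
  ultimately show ?thesis
    by (simp add: a_fin_def Z_poly_def fcomp_zero_Suc fmap_def)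
qed

text \<open>The sign matters later: it keeps 1 minus a constant coefficient within 1, where a bound
  on the absolute value would only give 2.\<close>

lemma a_fin_0_bounds: "0 \<le> a_fin d 0 n \<and> a_fin d 0 n \<le> 1"
proof (induction n arbitrary: d)
  case (Suc n)
  show ?case using Suc[of "\<lambda>k. d (Suc k)"] by (auto simp: a_fin_0_Suc)
qed simp

lemma abs_a_fin_le: "\<bar>a_fin d k n\<bar> \<le> 2 ^ k"
proof (induction n arbitrary: d k)
  case (Suc n)
  show ?case
  proof (cases k)
    case 0
    then show ?thesis using a_fin_0_bounds[of d "Suc n"] by simp
  next
    case (Suc j)
    let ?d = "\<lambda>k. d (Suc k)"
    have 1: "\<bar>a_fin ?d (Suc j) n\<bar> \<le> 2 ^ Suc j" "\<bar>a_fin ?d j n\<bar> \<le> 2 ^ j"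
      by (rule Suc.IH)+
    \<comment> \<open>With this, the recursion gives
      \<open>2 ^ Suc j / 2 + 2 ^ j = 2 ^ Suc j\<close>, so the bound reproduces itself.\<close>
    have "\<bar>of_bool (j = 0) - a_fin ?d j n\<bar> \<le> 2 ^ j"
      using 1(2) a_fin_0_bounds[of ?d n] by (cases "j = 0") auto
    then show ?thesis using 1 Suc by (auto simp: a_fin_Suc_Suc)
  qed
qed simp

text \<open>The translation term cancels in differences. With
  \<open>B = 4 ^ j * (3 / 4) ^ n\<close>, half of the order \<open>Suc j\<close> bound
  \<open>4 * B\<close> plus the order \<open>j\<close> bound \<open>B\<close> is
  \<open>3 * B\<close>, the bound for \<open>Suc n\<close>; the ratio 3/4 arises as 1/2 +
  1/4.\<close>

lemma abs_a_fin_diff_le: "\<bar>a_fin d k (Suc n) - a_fin d k n\<bar> \<le> 4 ^ k * (3 / 4) ^ n"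
proof (induction n arbitrary: d k)
  case 0
  have "(1::real) \<le> 4 ^ k" by simp
  then show ?case
    by (cases k) (auto simp: a_fin_0_Suc a_fin_Suc_Suc simp del: one_le_power)
next
  case (Suc n)
  let ?d = "\<lambda>k. d (Suc k)"
  show ?case
  proof (cases k)
    case 0
    have "\<bar>a_fin ?d 0 (Suc n) - a_fin ?d 0 n\<bar> \<le> (3 / 4) ^ n"
      using Suc.IH[of ?d 0] by simp
    moreover have "(0::real) \<le> (3 / 4) ^ n" by simp
    ultimately show ?thesis
      unfolding 0 a_fin_0_Suc[of d] power_Suc power_0 by linarith
  next
    case (Suc j)
    have "\<bar>a_fin ?d (Suc j) (Suc n) - a_fin ?d (Suc j) n\<bar> \<le> 4 * (4 ^ j * (3 / 4) ^ n)"
      using Suc.IH[of ?d "Suc j"] by simp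
    moreover have "\<bar>a_fin ?d j (Suc n) - a_fin ?d j n\<bar> \<le> 4 ^ j * (3 / 4) ^ n"
      by (rule Suc.IH)
    moreover have "(4::real) ^ Suc j * (3 / 4) ^ Suc n = 3 * (4 ^ j * (3 / 4) ^ n)"
      by simp
    ultimately show ?thesis
      unfolding Suc a_fin_Suc_Suc[of d] by (auto simp: abs_le_iff)
  qed
qed

lemma a_fin_tendsto: "(\<lambda>n. a_fin d k n) \<longlonglongrightarrow> a_lim d k"
proof -
  have "summable (\<lambda>n. 4 ^ k * (3 / 4 :: real) ^ n)"
    by (intro summable_mult summable_geometric) simp
  then have "summable (\<lambda>n. a_fin d k (Suc n) - a_fin d k n)"
    by (rule summable_comparison_test') (simp add: abs_a_fin_diff_le)
  then have "convergent (\<lambda>n. \<Sum>i<n. a_fin d k (Suc i) - a_fin d k i)"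
    by (simp add: summable_iff_convergent)
  then show ?thesis
    by (simp add: sum_lessThan_telescope a_lim_def convergent_LIMSEQ_iff)
qed

lemma abs_a_lim_le: "\<bar>a_lim d k\<bar> \<le> 2 ^ k"
  by (rule LIMSEQ_le_const2[OF tendsto_rabs[OF a_fin_tendsto]]) (auto intro: abs_a_fin_le)

section \<open>Constant coefficient and binary value\<close>

lemma binary_value_sums: "(\<lambda>k. of_bool (d k) / 2 ^ (k + 1)) sums binary_value d"
proof -
  have "summable (\<lambda>k. (1 / 2 :: real) ^ k)"
    by (intro summable_geometric) simp
  then have "summable (\<lambda>k. of_bool (d k) / 2 ^ (k + 1) :: real)"
    by (rule summable_comparison_test') (auto simp: field_simps)
  then show ?thesis
    by (simp add: binary_value_def summable_sums)
qed

lemma a_fin_0_eq: "a_fin d 0 n = (\<Sum>k<n. of_bool (d k) / 2 ^ (k + 1))"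
proof (induction n arbitrary: d)
  case (Suc n)
  show ?case
    unfolding sum.lessThan_Suc_shift a_fin_0_Suc Suc
    by (simp add: sum_divide_distrib mult.commute)
qed simp

text \<open>The constant coefficients are the partial sums of the binary expansion, so
  \<open>binary_value\<close> inherits their bounds and recursion.\<close>

lemma a_lim_0: "a_lim d 0 = binary_value d"
  using a_fin_tendsto[of d 0] binary_value_sums[of d]
  unfolding a_fin_0_eq sums_def by (rule LIMSEQ_unique)

lemma binary_value_bounds: "0 \<le> binary_value d" "binary_value d \<le> 1"
proof -
  show "0 \<le> binary_value d"
    by (rule LIMSEQ_le_const[OF a_fin_tendsto[of d 0, unfolded a_lim_0]])
      (use a_fin_0_bounds in auto)
  show "binary_value d \<le> 1"
    by (rule LIMSEQ_le_const2[OF a_fin_tendsto[of d 0, unfolded a_lim_0]])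
      (use a_fin_0_bounds in auto)
qed

lemma binary_value_rec: "binary_value d = binary_value (\<lambda>k. d (Suc k)) / 2 + of_bool (d 0) / 2"
proof -
  have "(\<lambda>n. a_fin d 0 (Suc n)) \<longlonglongrightarrow> binary_value (\<lambda>k. d (Suc k)) / 2 + of_bool (d 0) / 2"
    unfolding a_fin_0_Suc a_lim_0[symmetric] by (intro tendsto_intros a_fin_tendsto) auto
  moreover have "(\<lambda>n. a_fin d 0 (Suc n)) \<longlonglongrightarrow> binary_value d"
    using LIMSEQ_Suc[OF a_fin_tendsto[of d 0]] by (simp add: a_lim_0)
  ultimately show ?thesis by (rule LIMSEQ_unique[rotated])
qed

text \<open>This is the limit of the coefficient recursion at \<open>k = 0\<close>; the conditional
  term will turn out to be \<open>2 * int_dist (binary_value d)\<close>.\<close>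

lemma a_lim_1_rec:
  "a_lim d 1 = a_lim (\<lambda>k. d (Suc k)) 1 / 2 +
    (if d 0 then 1 - binary_value (\<lambda>k. d (Suc k)) else binary_value (\<lambda>k. d (Suc k)))"
    (is "_ = ?r")
proof -
  have "(\<lambda>n. a_fin d (Suc 0) (Suc n)) \<longlonglongrightarrow> ?r"
    unfolding a_fin_Suc_Suc a_lim_0[symmetric]
    by (cases "d 0") (auto intro!: tendsto_intros a_fin_tendsto)
  moreover have "(\<lambda>n. a_fin d (Suc 0) (Suc n)) \<longlonglongrightarrow> a_lim d 1"
    using LIMSEQ_Suc[OF a_fin_tendsto[of d 1]] by simp
  ultimately show ?thesis by (rule LIMSEQ_unique[rotated])
qed

section \<open>Distance to the nearest integer and the Takagi function\<close>

lemma int_dist_eqI: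
  assumes "\<And>n::int. r \<le> \<bar>x - of_int n\<bar>" and "r = \<bar>x - of_int m\<bar>"
  shows "int_dist x = r"
  unfolding int_dist_def using assms by (intro cInf_eq_minimum) auto

lemma int_dist_of_le_half:
  assumes "0 \<le> x" "x \<le> 1 / 2"
  shows "int_dist x = x"
proof (rule int_dist_eqI[where m = 0])
  fix n :: int
  have "n \<le> 0 \<or> n \<ge> 1" by arith
  then have "real_of_int n \<le> 0 \<or> real_of_int n \<ge> 1" by simp
  then show "x \<le> \<bar>x - of_int n\<bar>" using assms by linarith
qed (use assms in auto)

lemma int_dist_of_ge_half:
  assumes "1 / 2 \<le> x" "x \<le> 1"
  shows "int_dist x = 1 - x"
proof (rule int_dist_eqI[where m = 1])
  fix n :: int
  have "n \<le> 0 \<or> n \<ge> 1" by arith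
  then have "real_of_int n \<le> 0 \<or> real_of_int n \<ge> 1" by simp
  then show "1 - x \<le> \<bar>x - of_int n\<bar>" using assms by linarith
qed (use assms in auto)

text \<open>Translation by \<open>m\<close> permutes the integers over which the infimum is
  taken.\<close>

lemma int_dist_add_int: "int_dist (x + of_int m) = int_dist x"
proof -
  have "range (\<lambda>n. \<bar>x + of_int m - of_int n\<bar>) = (\<lambda>n. \<bar>x - of_int n\<bar>) ` range (\<lambda>n. n - m)"
    unfolding image_image by (simp add: algebra_simps)
  also have "range (\<lambda>n. n - m) = UNIV"
    by (auto intro!: image_eqI[where x = "_ + m"])
  finally show ?thesis by (simp add: int_dist_def)
qed

text \<open>Periodicity reduces to \<open>frac x\<close>, where the explicit formulas apply. The
  crude bound 1 is enough for comparison with a geometric series.\<close>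

lemma int_dist_bounds: "0 \<le> int_dist x \<and> int_dist x \<le> 1"
proof -
  have "int_dist x = int_dist (frac x)"
    using int_dist_add_int[of "frac x" "\<lfloor>x\<rfloor>"] by (simp add: frac_def)
  moreover have "0 \<le> frac x" "frac x < 1"
    by (simp_all add: frac_lt_1)
  ultimately show ?thesis
    using int_dist_of_le_half[of "frac x"] int_dist_of_ge_half[of "frac x"]
    by (cases "frac x \<le> 1 / 2") auto
qed

lemma summable_takagi: "summable (\<lambda>n. int_dist (2 ^ n * x) / 2 ^ n)"
proof -
  have "summable (\<lambda>k. (1 / 2 :: real) ^ k)"
    by (intro summable_geometric) simp
  then show ?thesis
    by (rule summable_comparison_test')
      (use int_dist_bounds in \<open>auto simp: power_divide divide_right_mono\<close>)
qed

lemma takagi_rec: "takagi x = int_dist x + takagi (2 * x) / 2"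
proof -
  have "takagi x = (\<Sum>n. int_dist (2 ^ Suc n * x) / 2 ^ Suc n) + int_dist x"
    unfolding takagi_def using suminf_split_head[OF summable_takagi[of x]] by simp
  also have "(\<lambda>n. int_dist (2 ^ Suc n * x) / 2 ^ Suc n) =
      (\<lambda>n. int_dist (2 ^ n * (2 * x)) / 2 ^ n / 2)"
    by (simp add: mult_ac)
  also have "suminf \<dots> = takagi (2 * x) / 2"
    unfolding takagi_def by (rule suminf_divide[OF summable_takagi])
  finally show ?thesis by simp
qed

lemma takagi_add_int: "takagi (x + of_int m) = takagi x"
proof -
  have "int_dist (2 ^ n * (x + of_int m)) = int_dist (2 ^ n * x)" for n
    using int_dist_add_int[of "2 ^ n * x" "2 ^ n * m"] by (simp add: algebra_simps)
  then show ?thesis by (simp add: takagi_def)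
qed

lemma takagi_bounds: "0 \<le> takagi x" "takagi x \<le> 2"
proof -
  show "0 \<le> takagi x"
    unfolding takagi_def by (intro suminf_nonneg summable_takagi) (use int_dist_bounds in auto)
  have "takagi x \<le> (\<Sum>n. (1 / 2) ^ n)"
    unfolding takagi_def
    by (intro suminf_le summable_takagi summable_geometric)
      (use int_dist_bounds in \<open>auto simp: power_divide divide_right_mono\<close>)
  also have "\<dots> = 2"
    by (subst suminf_geometric) auto
  finally show "takagi x \<le> 2" .
qed

section \<open>The linear coefficient as a Takagi value\<close>

lemma a_lim_1_takagi_shift:
  "a_lim d 1 - 2 * takagi (binary_value d) =
    (a_lim (\<lambda>k. d (Suc k)) 1 - 2 * takagi (binary_value (\<lambda>k. d (Suc k)))) / 2"
proof -
  define x where "x = binary_value (\<lambda>k. d (Suc k))"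
  have x: "0 \<le> x" "x \<le> 1"
    unfolding x_def by (rule binary_value_bounds)+
  have v: "binary_value d = x / 2 + of_bool (d 0) / 2"
    unfolding x_def by (rule binary_value_rec)
  \<comment> \<open>Both formulas include the point 1/2, which covers \<open>x = 1\<close> after
    digit 0 and \<open>x = 0\<close> after digit 1.\<close>
  have "2 * int_dist (binary_value d) = (if d 0 then 1 - x else x)"
    using x int_dist_of_le_half[of "x / 2"] int_dist_of_ge_half[of "x / 2 + 1 / 2"]
    by (auto simp: v)
  \<comment> \<open>Doubling yields \<open>x\<close> plus the first digit, an integer that
    periodicity removes.\<close>
  moreover have "takagi (2 * binary_value d) = takagi x"
    using takagi_add_int[of x "of_bool (d 0)"] by (simp add: v add.commute)
  ultimately show ?thesis
    using a_lim_1_rec[of d] takagi_rec[of "binary_value d"] by (auto simp: x_def)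
qed

lemma a_lim_1: "a_lim d 1 = 2 * takagi (binary_value d)"
proof -
  define e where "e = (\<lambda>d. a_lim d 1 - 2 * takagi (binary_value d))"
  \<comment> \<open>The constant is 2 + 4, from the bounds on \<open>a_lim d 1\<close> and on twice
    \<open>takagi\<close>. It is uniform in \<open>d\<close>, so the halving can be iterated along
    the shifts.\<close>
  have "\<bar>e d\<bar> \<le> 6 * (1 / 2) ^ n" for n
  proof (induction n arbitrary: d)
    case 0
    show ?case
      using abs_a_lim_le[of d 1] takagi_bounds[of "binary_value d"] by (simp add: e_def abs_le_iff)
  next
    case (Suc n)
    have "e d = e (\<lambda>k. d (Suc k)) / 2"
      unfolding e_def by (rule a_lim_1_takagi_shift)
    then show ?case
      using Suc[of "\<lambda>k. d (Suc k)"] by simp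
  qed
  moreover have "(\<lambda>n. 6 * (1 / 2 :: real) ^ n) \<longlonglongrightarrow> 6 * 0"
    by (intro tendsto_intros) simp
  ultimately have "\<bar>e d\<bar> \<le> 0"
    by (intro LIMSEQ_le_const[where X = "\<lambda>n. 6 * (1 / 2) ^ n"]) auto
  then show ?thesis by (simp add: e_def)
qed

section \<open>Existence of binary expansions in \<open>Omega\<close>\<close>

lemma binary_value_surj:
  assumes "0 \<le> \<alpha>" "\<alpha> \<le> 1"
  shows "\<alpha> \<in> binary_value ` Omega"
proof (cases "\<alpha> = 1")
  case True
  \<comment> \<open>This sequence is its own shift, so its value \<open>v\<close> satisfies
    \<open>v = v/2 + 1/2\<close>.\<close>
  have "binary_value (\<lambda>_. True) = 1"
    using binary_value_rec[of "\<lambda>_. True"] by simp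
  then show ?thesis
    using True by (auto simp: Omega_def intro!: image_eqI[where x = "\<lambda>_. True"])
next
  case False
  \<comment> \<open>The orbit of \<alpha> under doubling modulo 1; its position relative to 1/2
    gives the digits, and \<open>x n / 2 ^ n\<close> is the remainder after \<open>n\<close>
    digits.\<close>
  define x where "x = (\<lambda>k::nat. frac (2 ^ k * \<alpha>))"
  define d where "d = (\<lambda>k. 1 / 2 \<le> x k)"
  have x: "0 \<le> x k" "x k < 1" for k
    by (simp_all add: x_def frac_lt_1)
  have rec: "x (Suc k) = 2 * x k - of_bool (d k)" for k
  proof -
    have "2 ^ Suc k * \<alpha> - (2 * x k - of_bool (d k)) = of_int (2 * \<lfloor>2 ^ k * \<alpha>\<rfloor> + of_bool (d k))"
      by (simp add: x_def frac_def)
    then have "2 ^ Suc k * \<alpha> - (2 * x k - of_bool (d k)) \<in> \<int>"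
      by (metis Ints_of_int)
    then have "frac (2 ^ Suc k * \<alpha>) = 2 * x k - of_bool (d k)"
      using x[of k] unfolding frac_unique_iff by (auto simp: d_def)
    then show ?thesis
      by (simp add: x_def)
  qed
  have "\<alpha> = (\<Sum>k<n. of_bool (d k) / 2 ^ (k + 1)) + x n / 2 ^ n" for n
  proof (induction n)
    case 0
    show ?case using assms False by (simp add: x_def frac_eq)
  next
    case (Suc n)
    show ?case by (subst Suc) (simp add: rec field_simps)
  qed
  then have eq: "(\<Sum>k<n. of_bool (d k) / 2 ^ (k + 1)) = \<alpha> - x n / 2 ^ n" for n
    by (simp add: algebra_simps)
  have "(\<lambda>n. x n / 2 ^ n) \<longlonglongrightarrow> 0"
  proof (rule tendsto_sandwich)
    show "\<forall>\<^sub>F n in sequentially. 0 \<le> x n / 2 ^ n"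
      using x by simp
    show "\<forall>\<^sub>F n in sequentially. x n / 2 ^ n \<le> (1 / 2) ^ n"
      using x by (auto simp: power_divide divide_right_mono less_imp_le)
    show "(\<lambda>n. (1 / 2 :: real) ^ n) \<longlonglongrightarrow> 0"
      by (intro LIMSEQ_power_zero) simp
  qed simp
  then have "(\<lambda>n. \<alpha> - x n / 2 ^ n) \<longlonglongrightarrow> \<alpha> - 0"
    by (intro tendsto_intros)
  then have "binary_value d = \<alpha>"
    using binary_value_sums[of d] unfolding sums_def eq by (simp add: LIMSEQ_unique)
  moreover have "\<not> (\<forall>\<^sub>F k in sequentially. d k)"
  proof
    assume "\<forall>\<^sub>F k in sequentially. d k"
    then obtain N where N: "\<And>k. k \<ge> N \<Longrightarrow> d k"
      by (auto simp: eventually_sequentially)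
    \<comment> \<open>With all digits 1 from \<open>N\<close> on, the positive gap
      \<open>1 - x N\<close> doubles at each step, yet no gap can exceed 1.\<close>
    have *: "1 - x (N + m) = 2 ^ m * (1 - x N)" for m
      by (induction m) (simp_all add: rec N algebra_simps)
    obtain m where "1 / (1 - x N) < 2 ^ m"
      using real_arch_pow[of 2] by auto
    then have "1 < 2 ^ m * (1 - x N)"
      using x[of N] by (simp add: field_simps)
    then show False
      using *[of m] x[of "N + m"] by simp
  qed
  ultimately show ?thesis
    by (auto simp: Omega_def)
qed

section \<open>Differentiating the power series at 0\<close>

lemma Z_has_vector_derivative:
  "(Z d has_vector_derivative \<i> * of_real (a_lim d 1)) (at 0)"
proof -
  define c where "c = (\<lambda>k. complex_of_real (a_lim d k))"
  \<comment> \<open>Any nonzero point of modulus below 1/2 would serve: \<open>2 ^ k\<close> bounds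
    the coefficients, and 0 lies inside the resulting disc.\<close>
  have "summable (\<lambda>k. c k * (1 / 4) ^ k)"
  proof (rule summable_comparison_test')
    show "summable (\<lambda>k. (1 / 2 :: real) ^ k)"
      by (intro summable_geometric) simp
    fix k :: nat
    have "norm (c k * (1 / 4) ^ k) = \<bar>a_lim d k\<bar> * (1 / 4) ^ k"
      by (simp add: c_def norm_mult norm_power norm_divide)
    also have "\<dots> \<le> 2 ^ k * (1 / 4) ^ k"
      by (intro mult_right_mono abs_a_lim_le) simp
    also have "\<dots> = (1 / 2) ^ k"
      by (simp flip: power_mult_distrib)
    finally show "norm (c k * (1 / 4) ^ k) \<le> (1 / 2) ^ k" .
  qed
  then have "((\<lambda>z. \<Sum>k. c k * z ^ k) has_field_derivative (\<Sum>k. diffs c k * 0 ^ k)) (at 0)"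
    by (rule termdiffs_strong) simp
  \<comment> \<open>Only the term \<open>diffs c 0 = c 1\<close> survives at 0; writing 0 as
    \<open>\<i> * of_real 0\<close> prepares the chain rule.\<close>
  then have "((\<lambda>z. \<Sum>k. c k * z ^ k) has_field_derivative c 1) (at (\<i> * of_real 0))"
    by (simp add: diffs_def)
  moreover have "((\<lambda>\<beta>. \<i> * of_real \<beta>) has_vector_derivative \<i>) (at 0)"
    by (auto intro!: derivative_eq_intros)
  ultimately have "((\<lambda>z. \<Sum>k. c k * z ^ k) \<circ> (\<lambda>\<beta>. \<i> * of_real \<beta>) has_vector_derivative \<i> * c 1) (at 0)"
    by (intro field_vector_diff_chain_at)
  moreover have "(\<lambda>z. \<Sum>k. c k * z ^ k) \<circ> (\<lambda>\<beta>. \<i> * of_real \<beta>) = Z d"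
    by (auto simp: Z_def c_def)
  ultimately show ?thesis by (simp add: c_def)
qed

theorem lemma4p4:
  fixes \<alpha> :: real
  assumes "\<alpha> \<in> {0..1}"
  shows "(Z (binary_digits \<alpha>) has_vector_derivative 2 * \<i> * of_real (takagi \<alpha>)) (at 0)"
proof -
  \<comment> \<open>\<open>inv_into\<close> is a right inverse on the image, so surjectivity onto
    the unit interval gives this.\<close>
  have "binary_value (binary_digits \<alpha>) = \<alpha>"
    unfolding binary_digits_def using assms by (simp add: f_inv_into_f binary_value_surj)
  then show ?thesis
    using Z_has_vector_derivative[of "binary_digits \<alpha>"] by (simp only: a_lim_1) (simp add: mult_ac)
qed

end
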